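(* Let $U\subset\mathbb{R}^2$ be open and let $\mathbf{x}:U\to\mathbb{R}^3$ be a smooth map. Then $\mathbf{x}$ is a frontal if and only if for every $p\in U$ there are a neighborhood $V_p\subset U$ of $p$ and smooth maps $\Omega:V_p\to\mathcal{M}_{3\times2}(\mathbb{R})$ and $\Lambda:V_p\to\mathcal{M}_{2\times2}(\mathbb{R})$ with $\mathrm{rank}(\Omega)=2$ on $V_p$ such that $D\mathbf{x}(q)=\Omega(q)\Lambda(q)^T$ for all $q\in V_p$.
   Context: Smooth means $C^\infty$. $D\mathbf{x}$ is the $3\times2$ Jacobian matrix of $\mathbf{x}$, with columns $\mathbf{x}_u,\mathbf{x}_v$. A smooth map $\mathbf{x}:U\to\mathbb{R}^3$ is a frontal if for every $p\in U$ there are an open neighborhood $V_p\subset U$ of $p$ and a smooth $\nu:V_p\to\mathbb{R}^3$ with $|\nu|=1$ and $\nu\cdot\mathbf{x}_u=\nu\cdot\mathbf{x}_v=0$ on $V_p$. *)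

theory Defs
  imports "HOL-Analysis.Analysis"
begin

(* C^k on an open set S: f has a total derivative at every point of S and all its directional
   derivatives are C^(k-1).  The value of f outside S is irrelevant, because S is open. *)
primrec C_k_on :: "nat \<Rightarrow> ('a::euclidean_space \<Rightarrow> 'b::real_normed_vector) \<Rightarrow> 'a set \<Rightarrow> bool" where
  "C_k_on 0 f S \<longleftrightarrow> continuous_on S f"
| "C_k_on (Suc k) f S \<longleftrightarrow>
     (\<forall>x\<in>S. f differentiable (at x)) \<and>
     (\<forall>v. C_k_on k (\<lambda>x. frechet_derivative f (at x) v) S)"

definition smooth_on :: "('a::euclidean_space \<Rightarrow> 'b::real_normed_vector) \<Rightarrow> 'a set \<Rightarrow> bool" where
  "smooth_on f S \<longleftrightarrow> (\<forall>k. C_k_on k f S)"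

(* column 1 and column 2 of the Jacobian are the partial derivatives x_u and x_v. *)
definition frontal_on :: "(real^2 \<Rightarrow> real^3) \<Rightarrow> (real^2) set \<Rightarrow> bool" where
  "frontal_on x U \<longleftrightarrow>
     smooth_on x U \<and>
     (\<forall>p\<in>U. \<exists>V (\<nu> :: real^2 \<Rightarrow> real^3).
        open V \<and> p \<in> V \<and> V \<subseteq> U \<and> smooth_on \<nu> V \<and>
        (\<forall>q\<in>V. norm (\<nu> q) = 1 \<and>
           \<nu> q \<bullet> column 1 (jacobian x (at q)) = 0 \<and>
           \<nu> q \<bullet> column 2 (jacobian x (at q)) = 0))"

end

theory Submission
  imports Defs
begin

text \<open>If \<open>\<Omega>\<close> has rank 2, the normalised cross product of its columns is a smooth unit normal to
  their span, which contains the columns of \<open>\<Omega> \<Lambda>\<^sup>T\<close>. Conversely, near a point where the \<open>i\<close>-th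
  component of the unit normal does not vanish, the plane orthogonal to the normal is a graph over
  the coordinate plane of the other two indices. The graph basis \<open>\<Omega>\<close> depends smoothly on the normal,
  and the coefficients of \<open>x\<^sub>u\<close> and \<open>x\<^sub>v\<close> in it are just their remaining two coordinates.\<close>

section \<open>Calculus of C^k maps on open sets\<close>

lemma C_k_on_cong:
  assumes "open S" "C_k_on k f S" "\<And>x. x \<in> S \<Longrightarrow> f x = g x"
  shows "C_k_on k g S"
  using assms(2,3)
proof (induction k arbitrary: f g)
  case 0
  then show ?case
    unfolding C_k_on.simps by (metis continuous_on_cong)
next
  case (Suc k)
  \<comment> \<open>As \<open>S\<close> is open, \<open>f\<close> and \<open>g\<close> agree near
    \<open>x\<close> and hence share their derivative there, whatever their values outside
    \<open>S\<close>.\<close>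
  have D: "(g has_derivative frechet_derivative f (at x)) (at x)" if "x \<in> S" for x
  proof (rule has_derivative_transform_within_open[OF _ assms(1) that Suc.prems(2)])
    show "(f has_derivative frechet_derivative f (at x)) (at x)"
      using Suc.prems(1) that by (simp flip: frechet_derivative_works)
  qed
  have "C_k_on k (\<lambda>x. frechet_derivative g (at x) v) S" for v
  proof (rule Suc.IH)
    show "C_k_on k (\<lambda>x. frechet_derivative f (at x) v) S"
      using Suc.prems(1) by simp
    show "frechet_derivative f (at x) v = frechet_derivative g (at x) v" if "x \<in> S" for x
      using frechet_derivative_at[OF D[OF that]] by simp
  qed
  with D show ?case
    unfolding C_k_on.simps differentiable_def by blast
qed

text \<open>By uniqueness of the derivative, an explicit formula \<open>f'\<close> can stand in for
  the chosen \<open>frechet_derivative\<close>, so the usual differentiation rules feed directly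
  into inductions on \<open>k\<close>.\<close>

lemma C_k_on_SucI:
  assumes "open S" "\<And>x. x \<in> S \<Longrightarrow> (f has_derivative f' x) (at x)"
    and "\<And>v. C_k_on k (\<lambda>x. f' x v) S"
  shows "C_k_on (Suc k) f S"
proof -
  have "C_k_on k (\<lambda>x. frechet_derivative f (at x) v) S" for v
    by (rule C_k_on_cong[OF assms(1) assms(3)[of v]])
      (simp flip: frechet_derivative_at[OF assms(2)])
  with assms(2) show ?thesis
    by (auto simp: differentiable_def)
qed

lemma C_k_on_Suc_has_derivative:
  assumes "C_k_on (Suc k) f S" "x \<in> S"
  shows "(f has_derivative frechet_derivative f (at x)) (at x)"
  using assms by (simp add: frechet_derivative_works)

lemma C_k_on_SucD: "C_k_on (Suc k) f S \<Longrightarrow> C_k_on k f S"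
proof (induction k arbitrary: f)
  case 0
  then show ?case
    by (auto intro!: continuous_at_imp_continuous_on differentiable_imp_continuous_within)
qed auto

lemma C_k_on_subset: "C_k_on k f S \<Longrightarrow> T \<subseteq> S \<Longrightarrow> C_k_on k f T"
  by (induction k arbitrary: f) (auto intro: continuous_on_subset)

lemma C_k_on_const: "C_k_on k (\<lambda>x. c) S"
  by (induction k arbitrary: c) auto

lemma C_k_on_add:
  assumes "open S" "C_k_on k f S" "C_k_on k g S"
  shows "C_k_on k (\<lambda>x. f x + g x) S"
  using assms(2,3)
proof (induction k arbitrary: f g)
  case 0
  then show ?case by (auto intro: continuous_intros)
next
  case (Suc k)
  show ?case
    using Suc.prems
    by (intro C_k_on_SucI[OF assms(1) has_derivative_add[OF
            C_k_on_Suc_has_derivative[OF Suc.prems(1)] C_k_on_Suc_has_derivative[OF Suc.prems(2)]]]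
          Suc.IH) auto
qed

text \<open>The product rule gives a sum of two products of the same form, to which the induction
  hypothesis applies. Scalar multiples, inner products and cross products are all instances.\<close>

lemma (in bounded_bilinear) C_k_on:
  assumes "open S" "C_k_on k f S" "C_k_on k g S"
  shows "C_k_on k (\<lambda>x. prod (f x) (g x)) S"
  using assms(2,3)
proof (induction k arbitrary: f g)
  case 0
  then show ?case by (auto intro: continuous_on)
next
  case (Suc k)
  have "C_k_on k (\<lambda>x. prod (f x) (frechet_derivative g (at x) v)
      + prod (frechet_derivative f (at x) v) (g x)) S" for v
    using Suc.prems
    by (intro C_k_on_add assms(1) Suc.IH C_k_on_SucD[OF Suc.prems(1)] C_k_on_SucD[OF Suc.prems(2)]) auto
  then show ?case
    by (intro C_k_on_SucI[OF assms(1)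
          FDERIV[OF C_k_on_Suc_has_derivative[OF Suc.prems(1)]
                    C_k_on_Suc_has_derivative[OF Suc.prems(2)]]])
qed

text \<open>The derivative of a power is a power with exponent \<open>a - 1\<close> times a C^k
  factor, so the induction runs over all exponents at once. Reciprocals and norms are reduced to
  this case.\<close>

lemma C_k_on_powr:
  assumes "open S" "C_k_on k f S" "\<And>x. x \<in> S \<Longrightarrow> f x > (0::real)"
  shows "C_k_on k (\<lambda>x. f x powr a) S"
  using assms(2)
proof (induction k arbitrary: a)
  case 0
  have "f x \<noteq> 0" if "x \<in> S" for x using assms(3)[OF that] by simp
  with 0 show ?case by (simp add: continuous_on_powr)
next
  case (Suc k)
  let ?D = "\<lambda>x v. a * f x powr (a - 1) * frechet_derivative f (at x) v"
  have "((\<lambda>x. f x powr a) has_derivative ?D x) (at x)" if "x \<in> S" for x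
  proof -
    have "((\<lambda>y. y powr a) has_derivative (*) (a * f x powr (a - 1))) (at (f x))"
      using has_real_derivative_powr[OF assms(3)[OF that], of a]
      by (simp add: has_field_derivative_def)
    from has_derivative_compose[OF C_k_on_Suc_has_derivative[OF Suc.prems that] this]
    show ?thesis .
  qed
  moreover have "C_k_on k (\<lambda>x. ?D x v) S" for v
  proof -
    have "C_k_on k (\<lambda>x. f x powr (a - 1)) S"
      by (rule Suc.IH[OF C_k_on_SucD[OF Suc.prems]])
    moreover have "C_k_on k (\<lambda>x. frechet_derivative f (at x) v) S"
      using Suc.prems by simp
    ultimately show ?thesis
      by (intro bounded_bilinear.C_k_on[OF bounded_bilinear_mult] assms(1) C_k_on_const)
  qed
  ultimately show ?case
    by (rule C_k_on_SucI[OF assms(1), where f' = ?D])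
qed

section \<open>Closure properties of smooth maps\<close>

lemma smooth_on_cong:
  "\<lbrakk>open S; smooth_on f S; \<And>x. x \<in> S \<Longrightarrow> f x = g x\<rbrakk> \<Longrightarrow> smooth_on g S"
  unfolding smooth_on_def using C_k_on_cong by blast

lemma smooth_on_subset: "smooth_on f S \<Longrightarrow> T \<subseteq> S \<Longrightarrow> smooth_on f T"
  unfolding smooth_on_def using C_k_on_subset by blast

lemma smooth_on_imp_continuous_on: "smooth_on f S \<Longrightarrow> continuous_on S f"
  unfolding smooth_on_def by (metis C_k_on.simps(1))

lemma smooth_on_frechet_derivative:
  "smooth_on f S \<Longrightarrow> smooth_on (\<lambda>x. frechet_derivative f (at x) v) S"
  unfolding smooth_on_def by (metis C_k_on.simps(2))

lemma smooth_on_const: "smooth_on (\<lambda>x. c) S"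
  by (simp add: smooth_on_def C_k_on_const)

lemma smooth_on_add:
  "\<lbrakk>open S; smooth_on f S; smooth_on g S\<rbrakk> \<Longrightarrow> smooth_on (\<lambda>x. f x + g x) S"
  by (simp add: smooth_on_def C_k_on_add)

lemma (in bounded_bilinear) smooth_on:
  "\<lbrakk>open S; smooth_on f S; smooth_on g S\<rbrakk> \<Longrightarrow> smooth_on (\<lambda>x. prod (f x) (g x)) S"
  by (simp add: smooth_on_def C_k_on)

lemmas smooth_on_mult = bounded_bilinear.smooth_on[OF bounded_bilinear_mult]
lemmas smooth_on_scaleR = bounded_bilinear.smooth_on[OF bounded_bilinear_scaleR]
lemmas smooth_on_inner = bounded_bilinear.smooth_on[OF bounded_bilinear_inner]

text \<open>A linear map \<open>h\<close> becomes bilinear as \<open>r *\<^sub>R h y\<close>; the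
  product rule is then used with \<open>r\<close> constantly 1.\<close>

lemma smooth_on_bounded_linear:
  assumes "bounded_linear h" "open S" "smooth_on f S"
  shows "smooth_on (\<lambda>x. h (f x)) S"
proof -
  have "bounded_bilinear (\<lambda>(r::real) y. r *\<^sub>R h y)"
    using bounded_bilinear.comp[OF bounded_bilinear_scaleR bounded_linear_ident assms(1)] .
  from bounded_bilinear.smooth_on[OF this assms(2) smooth_on_const[of 1] assms(3)]
  show ?thesis by simp
qed

lemma smooth_on_sum:
  assumes "open S" "\<And>i. i \<in> I \<Longrightarrow> smooth_on (f i) S"
  shows "smooth_on (\<lambda>x. \<Sum>i\<in>I. f i x) S"
  using assms(2)
  by (induction I rule: infinite_finite_induct)
    (auto intro: smooth_on_const smooth_on_add assms(1))

lemma smooth_on_vec_nth: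
  "\<lbrakk>open S; smooth_on f S\<rbrakk> \<Longrightarrow> smooth_on (\<lambda>x. f x $ i) S"
  by (rule smooth_on_bounded_linear[OF bounded_linear_vec_nth])

text \<open>A vector is the sum of its components embedded by the linear isometries
  \<open>axis i\<close>. Components may be vectors themselves, so two applications handle matrices
  entrywise.\<close>

lemma smooth_on_vecI:
  fixes f :: "'a::euclidean_space \<Rightarrow> 'b::real_normed_vector ^ 'n"
  assumes "open S" "\<And>i. smooth_on (\<lambda>x. f x $ i) S"
  shows "smooth_on f S"
proof -
  have norm_axis: "norm (axis i y :: 'b ^ 'n) = norm y" for i y
  proof -
    have "(norm ((axis i y :: 'b ^ 'n) $ j))\<^sup>2 = (if j = i then (norm y)\<^sup>2 else 0)" for j
      by (simp add: axis_def)
    then show ?thesis by (simp add: norm_vec_def L2_set_def)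
  qed
  have "bounded_linear (axis i :: 'b \<Rightarrow> 'b ^ 'n)" for i
    by (rule bounded_linear_intro[where K = 1])
      (simp_all only: norm_axis, simp_all add: axis_def vec_eq_iff)
  from smooth_on_bounded_linear[OF this assms]
  have "smooth_on (\<lambda>x. \<Sum>i\<in>UNIV. axis i (f x $ i)) S"
    by (rule smooth_on_sum[OF assms(1)])
  moreover have "(\<Sum>i\<in>UNIV. axis i (y $ i)) = y" for y :: "'b ^ 'n"
    by (simp add: vec_eq_iff axis_def)
  ultimately show ?thesis by simp
qed

lemma smooth_on_powr:
  assumes "open S" "smooth_on f S" "\<And>x. x \<in> S \<Longrightarrow> f x > (0::real)"
  shows "smooth_on (\<lambda>x. f x powr a) S"
  using assms unfolding smooth_on_def by (intro allI C_k_on_powr) auto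

text \<open>Since \<open>f\<close> may be negative, the power rule is applied to its square: 1/f = f
  * (f^2)^(-1).\<close>

lemma smooth_on_inverse:
  fixes f :: "'a::euclidean_space \<Rightarrow> real"
  assumes "open S" "smooth_on f S" "\<And>x. x \<in> S \<Longrightarrow> f x \<noteq> 0"
  shows "smooth_on (\<lambda>x. inverse (f x)) S"
proof (rule smooth_on_cong[OF assms(1)])
  have "smooth_on (\<lambda>x. (f x * f x) powr (- 1)) S"
    by (rule smooth_on_powr[OF assms(1) smooth_on_mult[OF assms(1,2,2)]])
      (metis assms(3) not_real_square_gt_zero)
  then show "smooth_on (\<lambda>x. f x * (f x * f x) powr (- 1)) S"
    by (intro smooth_on_mult assms)
  show "f x * (f x * f x) powr (- 1) = inverse (f x)" if "x \<in> S" for x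
  proof -
    have "(f x * f x) powr (- 1) = inverse (f x * f x)"
      unfolding powr_minus by simp
    then show ?thesis
      using assms(3)[OF that] by simp
  qed
qed

lemma smooth_on_norm:
  fixes f :: "'a::euclidean_space \<Rightarrow> 'b::real_inner"
  assumes "open S" "smooth_on f S" "\<And>x. x \<in> S \<Longrightarrow> f x \<noteq> 0"
  shows "smooth_on (\<lambda>x. norm (f x)) S"
proof (rule smooth_on_cong[OF assms(1)])
  show "smooth_on (\<lambda>x. (f x \<bullet> f x) powr (1/2)) S"
    by (rule smooth_on_powr[OF assms(1) smooth_on_inner[OF assms(1,2,2)]])
      (simp add: assms(3))
qed (simp add: powr_half_sqrt norm_eq_sqrt_inner)

section \<open>Jacobians, rank 2 matrices and their unit normals\<close>

lemma column_jacobian: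
  "column m (jacobian f (at q)) = frechet_derivative f (at q) (axis m 1)"
  by (simp add: jacobian_def matrix_def column_def)

lemma smooth_on_jacobian_nth:
  assumes "open S" "smooth_on f S"
  shows "smooth_on (\<lambda>q. jacobian f (at q) $ r $ m) S"
proof -
  have "smooth_on (\<lambda>q. column m (jacobian f (at q)) $ r) S"
    unfolding column_jacobian by (intro smooth_on_vec_nth smooth_on_frechet_derivative assms)
  then show ?thesis by (simp add: column_def)
qed

text \<open>A vanishing cross product makes the columns linearly dependent. The coefficients of a
  dependence form a nonzero kernel vector, while a matrix of full column rank is injective.\<close>

lemma cross3_columns_nonzero:
  fixes A :: "real^2^3"
  assumes "rank A = 2"
  shows "cross3 (column 1 A) (column 2 A) \<noteq> 0"
proof
  assume "cross3 (column 1 A) (column 2 A) = 0"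
  then have "collinear {0, column 1 A, column 2 A}"
    by (simp add: cross_eq_0)
  then consider "column 1 A = 0" | "column 2 A = 0" | c where "column 2 A = c *\<^sub>R column 1 A"
    unfolding collinear_lemma by blast
  then obtain c d where "c \<noteq> 0 \<or> d \<noteq> 0" and "c *\<^sub>R column 1 A + d *\<^sub>R column 2 A = 0"
  proof cases
    case 1
    then show ?thesis by (intro that[of 1 0]) auto
  next
    case 2
    then show ?thesis by (intro that[of 0 1]) auto
  next
    case (3 c)
    then show ?thesis by (intro that[of "- c" 1]) auto
  qed
  then have "A *v vector [c, d] = 0" and "(vector [c, d] :: real^2) \<noteq> 0"
    by (auto simp: matrix_vector_mult_def column_def vec_eq_iff sum_2 forall_2 mult.commute)
  moreover have "inj ((*v) A)"
    using assms full_rank_injective[of A] by simp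
  ultimately show False
    by (metis injD matrix_vector_mult_0_right)
qed

text \<open>Column \<open>m\<close> of the product is the combination of the columns of
  \<open>\<Omega>\<close> with coefficients from row \<open>m\<close> of
  \<open>\<Lambda>\<close>.\<close>

lemma inner_column_mult_transpose:
  fixes \<Omega> :: "real^2^3" and \<Lambda> :: "real^2^2"
  assumes "n \<bullet> column 1 \<Omega> = 0" "n \<bullet> column 2 \<Omega> = 0"
  shows "n \<bullet> column m (\<Omega> ** transpose \<Lambda>) = 0"
proof -
  have "column m (\<Omega> ** transpose \<Lambda>) = \<Lambda>$m$1 *\<^sub>R column 1 \<Omega> + \<Lambda>$m$2 *\<^sub>R column 2 \<Omega>"
    by (simp add: vec_eq_iff column_def matrix_matrix_mult_def transpose_def sum_2)
  then show ?thesis using assms by (simp add: inner_add_right)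
qed

text \<open>The rank condition keeps the cross product of the columns away from zero on all of
  \<open>V\<close>, so dividing by its norm is smooth there.\<close>

lemma smooth_unit_normal:
  fixes \<Omega> :: "real^2 \<Rightarrow> real^2^3"
  assumes "open V" "smooth_on \<Omega> V" "\<forall>q\<in>V. rank (\<Omega> q) = 2"
  shows "\<exists>\<nu>. smooth_on \<nu> V \<and>
    (\<forall>q\<in>V. norm (\<nu> q) = 1 \<and> \<nu> q \<bullet> column 1 (\<Omega> q) = 0 \<and> \<nu> q \<bullet> column 2 (\<Omega> q) = 0)"
proof (intro exI conjI[of "smooth_on _ _"] ballI)
  let ?w = "\<lambda>q. cross3 (column 1 (\<Omega> q)) (column 2 (\<Omega> q))"
  have col: "smooth_on (\<lambda>q. column m (\<Omega> q)) V" for m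
    by (rule smooth_on_vecI[OF assms(1)])
      (simp add: column_def smooth_on_vec_nth assms)
  have "bounded_bilinear cross3"
    using bilinear_cross by (simp add: bilinear_conv_bounded_bilinear)
  then have w: "smooth_on ?w V"
    by (rule bounded_bilinear.smooth_on) (intro assms col)+
  have nz: "?w q \<noteq> 0" if "q \<in> V" for q
    using cross3_columns_nonzero assms(3) that by blast
  show "smooth_on (\<lambda>q. inverse (norm (?w q)) *\<^sub>R ?w q) V"
    by (intro smooth_on_scaleR smooth_on_inverse smooth_on_norm w assms(1)) (auto simp: nz)
  show "norm (inverse (norm (?w q)) *\<^sub>R ?w q) = 1
      \<and> (inverse (norm (?w q)) *\<^sub>R ?w q) \<bullet> column 1 (\<Omega> q) = 0
      \<and> (inverse (norm (?w q)) *\<^sub>R ?w q) \<bullet> column 2 (\<Omega> q) = 0" if "q \<in> V" for q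
    using nz[OF that] by (simp add: dot_cross_self)
qed

section \<open>Planes in 3-space as graphs over coordinate planes\<close>

lemma exists_complement_enum_3:
  fixes i :: 3
  obtains \<sigma> :: "2 \<Rightarrow> 3" where "inj \<sigma>" "range \<sigma> = UNIV - {i}"
proof -
  have "card (UNIV :: 2 set) = card (UNIV - {i})" by (simp add: card_Diff_singleton)
  then obtain \<sigma> :: "2 \<Rightarrow> 3" where "bij_betw \<sigma> UNIV (UNIV - {i})"
    by (metis finite finite_same_card_bij)
  then show ?thesis using that by (auto simp: bij_betw_def)
qed

text \<open>When \<open>n $ i \<noteq> 0\<close>, the plane orthogonal to \<open>n\<close> is a graph over the coordinate plane
  \<open>y $ i = 0\<close>. The columns are the lifts of the two unit vectors of that coordinate plane, which
  \<open>\<sigma>\<close> enumerates.\<close>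

definition graph_basis :: "3 \<Rightarrow> (2 \<Rightarrow> 3) \<Rightarrow> real^3 \<Rightarrow> real^2^3" where
  "graph_basis i \<sigma> n = (\<chi> r l. if r = i then - (n $ \<sigma> l * inverse (n $ i)) else if r = \<sigma> l then 1 else 0)"

text \<open>The rows other than row \<open>i\<close> form the identity matrix. Both the rank and the
  coefficients in this basis are read off from them.\<close>

lemma graph_basis_nth:
  assumes "inj \<sigma>" "range \<sigma> = UNIV - {i}"
  shows "graph_basis i \<sigma> n $ \<sigma> l $ m = (if l = m then 1 else 0)"
proof -
  have "\<sigma> l \<noteq> i" using assms(2) by auto
  then show ?thesis by (simp add: graph_basis_def inj_eq[OF assms(1)])
qed

lemma rank_graph_basis:
  assumes "inj \<sigma>" "range \<sigma> = UNIV - {i}"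
  shows "rank (graph_basis i \<sigma> n) = 2"
proof -
  have "(graph_basis i \<sigma> n *v c) $ \<sigma> l = c $ l" for c l
    by (simp add: matrix_vector_mult_def graph_basis_nth[OF assms] mult_delta_left)
  then have "inj ((*v) (graph_basis i \<sigma> n))"
    by (metis injI vec_eq_iff)
  then show ?thesis using full_rank_injective[of "graph_basis i \<sigma> n"] by simp
qed

text \<open>In the rows \<open>\<sigma> l\<close> the basis is the identity, so the product copies
  those rows of \<open>A\<close>. The entries in row \<open>i\<close> are forced: orthogonality to
  \<open>n\<close> is solved for them, dividing by \<open>n $ i\<close>.\<close>

lemma graph_basis_mult:
  fixes A :: "real^2^3"
  assumes "inj \<sigma>" "range \<sigma> = UNIV - {i}" "n $ i \<noteq> 0" "\<And>m. n \<bullet> column m A = 0"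
  shows "graph_basis i \<sigma> n ** transpose (\<chi> m l. A $ \<sigma> l $ m) = A"
proof -
  have "(\<Sum>l\<in>UNIV. graph_basis i \<sigma> n $ r $ l * A $ \<sigma> l $ m) = A $ r $ m" for r m
  proof (cases "r = i")
    case True
    have "0 = (\<Sum>r\<in>UNIV. n $ r * A $ r $ m)"
      using assms(4)[of m] by (simp add: inner_vec_def column_def)
    also have "\<dots> = n $ i * A $ i $ m + (\<Sum>r\<in>range \<sigma>. n $ r * A $ r $ m)"
      unfolding assms(2) by (simp add: sum.remove[of UNIV i])
    also have "(\<Sum>r\<in>range \<sigma>. n $ r * A $ r $ m) = (\<Sum>l\<in>UNIV. n $ \<sigma> l * A $ \<sigma> l $ m)"
      by (simp add: sum.reindex[OF assms(1)])
    finally have "A $ i $ m = - (\<Sum>l\<in>UNIV. n $ \<sigma> l * A $ \<sigma> l $ m) * inverse (n $ i)"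
      using assms(3) by (simp add: field_simps)
    also have "\<dots> = (\<Sum>l\<in>UNIV. - (n $ \<sigma> l * inverse (n $ i)) * A $ \<sigma> l $ m)"
      by (simp add: sum_distrib_left sum_negf ac_simps)
    finally show ?thesis using True by (simp add: graph_basis_def)
  next
    case False
    then obtain l where "r = \<sigma> l" using assms(2) by blast
    then show ?thesis
      by (simp add: graph_basis_nth[OF assms(1,2)] mult_delta_left)
  qed
  then show ?thesis
    by (simp add: vec_eq_iff matrix_matrix_mult_def transpose_def)
qed

theorem proposition3p2:
  fixes U :: "(real^2) set" and x :: "real^2 \<Rightarrow> real^3"
  assumes "open U" and "smooth_on x U"
  shows "frontal_on x U \<longleftrightarrow>
    (\<forall>p\<in>U. \<exists>V (\<Omega> :: real^2 \<Rightarrow> real^2^3) (\<Lambda> :: real^2 \<Rightarrow> real^2^2).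
       open V \<and> p \<in> V \<and> V \<subseteq> U \<and> smooth_on \<Omega> V \<and> smooth_on \<Lambda> V \<and>
       (\<forall>q\<in>V. rank (\<Omega> q) = 2) \<and>
       (\<forall>q\<in>V. jacobian x (at q) = \<Omega> q ** transpose (\<Lambda> q)))"
    (is "_ \<longleftrightarrow> ?factors")
proof
  assume "frontal_on x U"
  show ?factors
  proof
    fix p assume "p \<in> U"
    with \<open>frontal_on x U\<close> obtain V and \<nu> :: "real^2 \<Rightarrow> real^3"
      where V: "open V" "p \<in> V" "V \<subseteq> U" and \<nu>: "smooth_on \<nu> V"
        and normal: "\<forall>q\<in>V. norm (\<nu> q) = 1 \<and>
           \<nu> q \<bullet> column 1 (jacobian x (at q)) = 0 \<and>
           \<nu> q \<bullet> column 2 (jacobian x (at q)) = 0"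
      unfolding frontal_on_def by metis
    have orth: "\<nu> q \<bullet> column m (jacobian x (at q)) = 0" if "q \<in> V" for q m
      using bspec[OF normal that] exhaust_2[of m] by auto
    have "\<nu> p \<noteq> 0" using bspec[OF normal V(2)] by auto
    then obtain i where i: "\<nu> p $ i \<noteq> 0"
      unfolding vec_eq_iff zero_index by blast
    \<comment> \<open>Listing the other two coordinates by \<open>\<sigma>\<close> treats the three
      possible values of \<open>i\<close> uniformly.\<close>
    obtain \<sigma> :: "2 \<Rightarrow> 3" where \<sigma>: "inj \<sigma>" "range \<sigma> = UNIV - {i}"
      by (rule exists_complement_enum_3)
    \<comment> \<open>The graph basis divides by component \<open>i\<close> of the normal, so
      \<open>V\<close> is shrunk to where this is nonzero, an open condition by continuity.\<close>
    define W where "W = {q \<in> V. \<nu> q $ i \<noteq> 0}"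
    have "W = V \<inter> (\<lambda>q. \<nu> q $ i) -` (- {0})" by (auto simp: W_def)
    then have "open W"
      using smooth_on_imp_continuous_on[OF smooth_on_vec_nth[OF V(1) \<nu>, of i]] V(1)
      by (simp add: continuous_open_preimage open_Compl)
    have \<nu>W: "smooth_on \<nu> W" and xW: "smooth_on x W"
      using V(3) by (auto simp: W_def intro!: smooth_on_subset[OF \<nu>] smooth_on_subset[OF assms(2)])
    let ?\<Omega> = "\<lambda>q. graph_basis i \<sigma> (\<nu> q)"
    \<comment> \<open>Row \<open>m\<close> holds the coefficients of column \<open>m\<close> of the
      Jacobian, which accounts for the transpose in the factorisation.\<close>
    let ?\<Lambda> = "\<lambda>q. (\<chi> m l. jacobian x (at q) $ \<sigma> l $ m) :: real^2^2"
    \<comment> \<open>The factor \<open>- 1\<close> expresses negation as a product, so that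
      \<open>smooth_on_mult\<close> covers it.\<close>
    have entry: "smooth_on (\<lambda>q. - 1 * (\<nu> q $ \<sigma> l * inverse (\<nu> q $ i))) W" for l
      using \<open>open W\<close>
      by (intro smooth_on_mult smooth_on_const smooth_on_inverse smooth_on_vec_nth \<nu>W)
        (auto simp: W_def)
    have "smooth_on (\<lambda>q. graph_basis i \<sigma> (\<nu> q) $ r $ l) W" for r l
      using entry[of l] by (cases "r = i"; cases "r = \<sigma> l")
        (simp_all add: graph_basis_def smooth_on_const)
    then have "smooth_on ?\<Omega> W"
      using \<open>open W\<close> by (intro smooth_on_vecI)
    moreover have "smooth_on ?\<Lambda> W"
      using \<open>open W\<close>
      by (intro smooth_on_vecI) (simp_all add: smooth_on_jacobian_nth xW)
    moreover have "rank (?\<Omega> q) = 2" for q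
      by (rule rank_graph_basis[OF \<sigma>])
    moreover have "jacobian x (at q) = ?\<Omega> q ** transpose (?\<Lambda> q)" if "q \<in> W" for q
      using that orth by (intro graph_basis_mult[OF \<sigma>, symmetric]) (auto simp: W_def)
    moreover have "p \<in> W" "W \<subseteq> U" using V i by (auto simp: W_def)
    ultimately show "\<exists>V (\<Omega> :: real^2 \<Rightarrow> real^2^3) (\<Lambda> :: real^2 \<Rightarrow> real^2^2).
       open V \<and> p \<in> V \<and> V \<subseteq> U \<and> smooth_on \<Omega> V \<and> smooth_on \<Lambda> V \<and>
       (\<forall>q\<in>V. rank (\<Omega> q) = 2) \<and>
       (\<forall>q\<in>V. jacobian x (at q) = \<Omega> q ** transpose (\<Lambda> q))"
      using \<open>open W\<close> by blast
  qed
next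
  assume factors: ?factors
  show "frontal_on x U"
    unfolding frontal_on_def
  proof (intro conjI ballI assms(2))
    fix p assume "p \<in> U"
    with factors obtain V and \<Omega> :: "real^2 \<Rightarrow> real^2^3" and \<Lambda> :: "real^2 \<Rightarrow> real^2^2"
      where V: "open V" "p \<in> V" "V \<subseteq> U" and \<Omega>: "smooth_on \<Omega> V" "\<forall>q\<in>V. rank (\<Omega> q) = 2"
        and J: "\<forall>q\<in>V. jacobian x (at q) = \<Omega> q ** transpose (\<Lambda> q)"
      by metis
    obtain \<nu> where \<nu>: "smooth_on \<nu> V"
      "\<forall>q\<in>V. norm (\<nu> q) = 1 \<and> \<nu> q \<bullet> column 1 (\<Omega> q) = 0 \<and> \<nu> q \<bullet> column 2 (\<Omega> q) = 0"
      using smooth_unit_normal[OF V(1) \<Omega>] by (elim exE conjE)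
    \<comment> \<open>The columns of the Jacobian lie in the span of those of
      \<open>\<Omega> q\<close>, so the same unit normal serves on the same
      \<open>V\<close>.\<close>
    have "norm (\<nu> q) = 1 \<and> \<nu> q \<bullet> column 1 (jacobian x (at q)) = 0
        \<and> \<nu> q \<bullet> column 2 (jacobian x (at q)) = 0" if "q \<in> V" for q
      unfolding bspec[OF J that] using bspec[OF \<nu>(2) that] inner_column_mult_transpose by blast
    then show "\<exists>V (\<nu> :: real^2 \<Rightarrow> real^3).
        open V \<and> p \<in> V \<and> V \<subseteq> U \<and> smooth_on \<nu> V \<and>
        (\<forall>q\<in>V. norm (\<nu> q) = 1 \<and>
           \<nu> q \<bullet> column 1 (jacobian x (at q)) = 0 \<and>
           \<nu> q \<bullet> column 2 (jacobian x (at q)) = 0)"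
      by (intro exI[of _ V] exI[of _ \<nu>] conjI V \<nu>(1) ballI) auto
  qed
qed

end
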